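(* Let $\alpha\in\mathbb Z\setminus\{0,1\}$, put $\gamma=\alpha^2-\alpha+1$, and let $(h_n)$ be the sequence with $h_0=0$, $h_1=1$, $h_2=-\alpha^2(\alpha-1)\gamma$, $h_3=-\alpha^6(\alpha-1)^3\gamma^3$, $h_4=\alpha^{12}(\alpha-1)^6\gamma^5$, and for $m\ge2$: $h_{2m+1}=h_{m+2}h_m^3-h_{m-1}h_{m+1}^3$, for $m\ge 3$: $h_{2m}=h_m\big(h_{m+2}h_{m-1}^2-h_{m-2}h_{m+1}^2\big)/h_2$. (i) If $n\equiv 1,17\pmod{18}$, then $h_n$ is a square. (ii) If $n\equiv 5,13\pmod{18}$, then $h_n$ is a square if and only if $\alpha$ is a square.
   Context: The sequence defined is the elliptic divisibility sequence attached to the point $(0,0)$ of order $9$ on the Tate normal form curve with $c=\alpha^2(\alpha-1)$, $b=c(\alpha(\alpha-1)+1)$; its ninth term is zero. Convention: an integer $m$ is called a square if $m=\pm\beta^2$ for some nonzero integer $\beta$. *)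

theory Defs
  imports Complex_Main "HOL-Number_Theory.Cong"
begin

text \<open>
  Squares are taken up to sign, and \<open>0\<close> is not a square. The root is always a nonzero integer;
  the argument may live in an overring of the integers such as \<open>rat\<close>, in which case being a square
  includes being an integer.
\<close>

definition signed_square :: "'a::ring_1 \<Rightarrow> bool" where
  "signed_square x \<longleftrightarrow>
    (\<exists>\<beta>::int. \<beta> \<noteq> 0 \<and> (x = of_int (\<beta>\<^sup>2) \<or> x = - of_int (\<beta>\<^sup>2)))"

end

theory Submission
  imports Defs
begin

text \<open>
  Every term is, up to sign, a monomial in \<open>\<alpha>\<close>, \<open>\<alpha> - 1\<close> and \<open>\<gamma>\<close>. With
  \<open>A = \<alpha>^14 (\<alpha> - 1)^8 \<gamma>^6\<close> and \<open>B = - \<alpha>^63 (\<alpha> - 1)^36 \<gamma>^27\<close>, which satisfy \<open>B^2 = A^9\<close>,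
  one has \<open>h (9 k + n) = h n A^(k n) B^(k^2)\<close>. Both recurrences are homogeneous for this quadratic
  twist, so the closed form needs to be verified only on one period of length 9, where it comes
  down to \<open>\<gamma> = \<alpha> (\<alpha> - 1) + 1\<close> and \<open>\<gamma> = \<alpha> + (\<alpha> - 1)^2\<close>. The parity of the
  exponents then decides which terms are squares.
\<close>

section \<open>Arithmetic of monomials in \<alpha>, \<alpha> - 1 and \<gamma>\<close>

definition mon :: "int \<Rightarrow> nat \<Rightarrow> nat \<Rightarrow> nat \<Rightarrow> int" where
  "mon \<alpha> a b c = \<alpha>^a * (\<alpha> - 1)^b * (\<alpha>\<^sup>2 - \<alpha> + 1)^c"

lemma mon_mult: "mon \<alpha> a b c * mon \<alpha> a' b' c' = mon \<alpha> (a + a') (b + b') (c + c')"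
  by (simp add: mon_def power_add)

lemma mon_mult_left:
  "mon \<alpha> a b c * (mon \<alpha> a' b' c' * x) = mon \<alpha> (a + a') (b + b') (c + c') * x"
  by (simp add: mon_def power_add)

lemma mon_power: "mon \<alpha> a b c ^ n = mon \<alpha> (a * n) (b * n) (c * n)"
  by (simp add: mon_def power_mult power_mult_distrib)

text \<open>This relation and the next two are the only additive facts that the recurrences require:
  everything else about monomials is bookkeeping of exponents.\<close>

lemma mon_alpha: "mon \<alpha> (a + 1) b c = mon \<alpha> a (b + 1) c + mon \<alpha> a b c"
  by (simp add: mon_def algebra_simps)

lemma mon_gamma: "mon \<alpha> a b (c + 1) = mon \<alpha> (a + 1) (b + 1) c + mon \<alpha> a b c"
  by (simp add: mon_def algebra_simps power2_eq_square)

lemma mon_gamma': "mon \<alpha> a b (c + 1) = mon \<alpha> a (b + 2) c + mon \<alpha> (a + 1) b c"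
  by (simp add: mon_def algebra_simps power2_eq_square)

text \<open>The factor \<gamma> = \<alpha> (\<alpha> - 1) + 1 is positive, since a product of
  consecutive integers is never negative.\<close>

lemma mon_nonzero:
  assumes "\<alpha> \<noteq> 0" "\<alpha> \<noteq> 1"
  shows "mon \<alpha> a b c \<noteq> 0"
proof -
  have "\<alpha>\<^sup>2 - \<alpha> + 1 = \<alpha> * (\<alpha> - 1) + 1"
    by (simp add: algebra_simps power2_eq_square)
  moreover have "\<alpha> * (\<alpha> - 1) \<ge> 0"
    by (cases "\<alpha> \<ge> 1") (auto intro: mult_nonneg_nonneg mult_nonpos_nonpos)
  ultimately show ?thesis
    using assms by (simp add: mon_def)
qed

section \<open>The closed form and its behaviour under shifts by 9\<close>

text \<open>The first five entries are the prescribed initial values; the other four are what the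
  recurrences then give.\<close>

definition eds9_base :: "int \<Rightarrow> nat \<Rightarrow> int" where
  "eds9_base \<alpha> r = [0, 1, - mon \<alpha> 2 1 1, - mon \<alpha> 6 3 3, mon \<alpha> 12 6 5, mon \<alpha> 19 10 8,
     - mon \<alpha> 27 15 12, - mon \<alpha> 37 21 16, mon \<alpha> 49 28 21] ! r"

definition eds9 :: "int \<Rightarrow> nat \<Rightarrow> int" where
  "eds9 \<alpha> n = eds9_base \<alpha> (n mod 9) * mon \<alpha> 14 8 6 ^ ((n div 9) * (n mod 9)) *
     (- mon \<alpha> 63 36 27) ^ (n div 9)\<^sup>2"

lemma eds9_values:
  "eds9 \<alpha> 0 = 0"
  "eds9 \<alpha> 1 = 1"
  "eds9 \<alpha> (Suc 0) = 1"
  "eds9 \<alpha> 2 = - mon \<alpha> 2 1 1"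
  "eds9 \<alpha> (Suc (Suc 0)) = - mon \<alpha> 2 1 1"
  "eds9 \<alpha> 3 = - mon \<alpha> 6 3 3"
  "eds9 \<alpha> 4 = mon \<alpha> 12 6 5"
  "eds9 \<alpha> 5 = mon \<alpha> 19 10 8"
  "eds9 \<alpha> 6 = - mon \<alpha> 27 15 12"
  "eds9 \<alpha> 7 = - mon \<alpha> 37 21 16"
  "eds9 \<alpha> 8 = mon \<alpha> 49 28 21"
  by (simp_all add: eds9_def eds9_base_def)

text \<open>With \<open>n = 9 * q + r\<close>, the square \<open>(k + q)^2\<close> has the cross
  term \<open>2 * k * q\<close>. The relation \<open>B^2 = A^9\<close> turns it into
  \<open>A^(9 * k * q)\<close>, which completes \<open>A^(k * r)\<close> to
  \<open>A^(k * n)\<close>.\<close>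

lemma eds9_shift:
  "eds9 \<alpha> (9 * k + n) =
     eds9 \<alpha> n * mon \<alpha> 14 8 6 ^ (k * n) * (- mon \<alpha> 63 36 27) ^ k\<^sup>2"
proof -
  define A B where "A = mon \<alpha> 14 8 6" and "B = - mon \<alpha> 63 36 27"
  define q r where "q = n div 9" and "r = n mod 9"
  have "B\<^sup>2 = A ^ 9"
    by (simp add: A_def B_def mon_power)
  then have "B ^ (2 * (k * q)) = A ^ (9 * (k * q))"
    by (simp add: power_mult)
  moreover have "(k + q)\<^sup>2 = k\<^sup>2 + q\<^sup>2 + 2 * (k * q)"
    by (simp add: power2_eq_square algebra_simps)
  moreover have "k * n = 9 * (k * q) + k * r"
    by (metis add_mult_distrib2 mult.left_commute mult_div_mod_eq q_def r_def)
  moreover have "(9 * k + n) div 9 = k + q" "(9 * k + n) mod 9 = r"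
    by (simp_all add: q_def r_def)
  ultimately show ?thesis
    unfolding eds9_def A_def[symmetric] B_def[symmetric] q_def[symmetric] r_def[symmetric]
    by (simp only: power_add add_mult_distrib add_mult_distrib2 mult_ac)
qed

text \<open>For an offset \<open>t < 9\<close> the recurrences reach index \<open>2 * t + 5\<close>,
  hence at most 21; the tables go exactly that far.\<close>

lemma eds9_values_9_to_17:
  "eds9 \<alpha> 9 = 0"
  "eds9 \<alpha> 10 = - mon \<alpha> 77 44 33"
  "eds9 \<alpha> 11 = mon \<alpha> 93 53 40"
  "eds9 \<alpha> 12 = mon \<alpha> 111 63 48"
  "eds9 \<alpha> 13 = - mon \<alpha> 131 74 56"
  "eds9 \<alpha> 14 = - mon \<alpha> 152 86 65"
  "eds9 \<alpha> 15 = mon \<alpha> 174 99 75"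
  "eds9 \<alpha> 16 = mon \<alpha> 198 113 85"
  "eds9 \<alpha> 17 = - mon \<alpha> 224 128 96"
  using eds9_shift[of \<alpha> 1 0] eds9_shift[of \<alpha> 1 1] eds9_shift[of \<alpha> 1 2] eds9_shift[of \<alpha> 1 3]
    eds9_shift[of \<alpha> 1 4] eds9_shift[of \<alpha> 1 5] eds9_shift[of \<alpha> 1 6] eds9_shift[of \<alpha> 1 7]
    eds9_shift[of \<alpha> 1 8]
  by (simp_all add: eds9_values mon_power mon_mult)

lemma eds9_values_18_to_21:
  "eds9 \<alpha> 18 = 0"
  "eds9 \<alpha> 19 = mon \<alpha> 280 160 120"
  "eds9 \<alpha> 20 = - mon \<alpha> 310 177 133"
  "eds9 \<alpha> 21 = - mon \<alpha> 342 195 147"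
  using eds9_shift[of \<alpha> 2 0] eds9_shift[of \<alpha> 2 1] eds9_shift[of \<alpha> 2 2] eds9_shift[of \<alpha> 2 3]
  by (simp_all add: eds9_values mon_power mon_mult)

lemmas eds9_small_values = eds9_values eds9_values_9_to_17 eds9_values_18_to_21

section \<open>The recurrences on one period\<close>

lemma less_9_cases:
  fixes t :: nat
  assumes "t < 9"
  obtains "t = 0" | "t = 1" | "t = 2" | "t = 3" | "t = 4" | "t = 5" | "t = 6" | "t = 7" | "t = 8"
  using assms by linarith

text \<open>This is the odd recurrence at \<open>m = t + 2\<close>, free of truncated subtraction.
  If an index divisible by 9 occurs, one of the three terms vanishes and the other two match as
  monomials. The remaining offsets 0, 1, 3, 4 are a relation for \<gamma> times a monomial.\<close>

lemma eds9_odd_period: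
  assumes "t < 9"
  shows "eds9 \<alpha> (2 * t + 5) =
    eds9 \<alpha> (t + 4) * eds9 \<alpha> (t + 2) ^ 3 - eds9 \<alpha> (t + 1) * eds9 \<alpha> (t + 3) ^ 3"
  using assms
proof (cases rule: less_9_cases)
  case 1
  then show ?thesis
    using mon_gamma[of \<alpha> 18 9 8]
    by (simp add: eds9_small_values mon_power mon_mult del: One_nat_def)
next
  case 2
  then show ?thesis
    using mon_gamma'[of \<alpha> 37 19 16]
    by (simp add: eds9_small_values mon_power mon_mult del: One_nat_def)
next
  case 4
  then show ?thesis
    using mon_gamma'[of \<alpha> 93 51 40]
    by (simp add: eds9_small_values mon_power mon_mult del: One_nat_def)
next
  case 5
  then show ?thesis
    using mon_gamma[of \<alpha> 130 73 56]
    by (simp add: eds9_small_values mon_power mon_mult del: One_nat_def)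
qed (simp_all add: eds9_small_values mon_power mon_mult del: One_nat_def)

text \<open>Multiplying by the second term keeps the identity in the integers. Only the offsets 1 to
  4 involve no index divisible by 9 and need an additive relation.\<close>

lemma eds9_even_period:
  assumes "t < 9"
  shows "eds9 \<alpha> (2 * t + 4) * eds9 \<alpha> 2 =
    eds9 \<alpha> (t + 2) *
      (eds9 \<alpha> (t + 4) * (eds9 \<alpha> (t + 1))\<^sup>2 - eds9 \<alpha> t * (eds9 \<alpha> (t + 3))\<^sup>2)"
  using assms
proof (cases rule: less_9_cases)
  case 2
  then show ?thesis
    using mon_alpha[of \<alpha> 29 15 13]
    by (simp add: eds9_small_values mon_power mon_mult mon_mult_left algebra_simps del: One_nat_def)
next
  case 3
  then show ?thesis
    using mon_gamma'[of \<alpha> 51 27 22]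
    by (simp add: eds9_small_values mon_power mon_mult mon_mult_left algebra_simps del: One_nat_def)
next
  case 4
  then show ?thesis
    using mon_gamma'[of \<alpha> 79 43 34]
    by (simp add: eds9_small_values mon_power mon_mult mon_mult_left algebra_simps del: One_nat_def)
next
  case 5
  then show ?thesis
    using mon_alpha[of \<alpha> 113 63 49]
    by (simp add: eds9_small_values mon_power mon_mult mon_mult_left algebra_simps del: One_nat_def)
qed (simp_all add: eds9_small_values mon_power mon_mult mon_mult_left algebra_simps del: One_nat_def)

section \<open>The recurrences at all indices\<close>

text \<open>Homogeneity of the twist: four shifts by \<open>k\<close> periods contribute
  \<open>B^(4 * k^2)\<close>, as does one shift by \<open>2 * k\<close> periods. The powers of
  \<open>A\<close> agree when the four indices add up to twice the single one.\<close>

lemma twist_mult: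
  fixes A B :: int
  assumes "a + b + c + d = 2 * e"
  shows "(A ^ (k * a) * B ^ k\<^sup>2) * (A ^ (k * b) * B ^ k\<^sup>2) * (A ^ (k * c) * B ^ k\<^sup>2) *
    (A ^ (k * d) * B ^ k\<^sup>2) = A ^ (2 * k * e) * B ^ (2 * k)\<^sup>2"
proof -
  have "k * a + k * b + k * c + k * d = k * (a + b + c + d)"
    by (simp add: algebra_simps)
  also have "\<dots> = 2 * k * e"
    by (simp add: assms)
  finally have "A ^ (2 * k * e) = A ^ (k * a) * A ^ (k * b) * A ^ (k * c) * A ^ (k * d)"
    by (metis power_add)
  moreover have "(2 * k)\<^sup>2 = k\<^sup>2 + k\<^sup>2 + k\<^sup>2 + k\<^sup>2"
    by (simp add: power_mult_distrib)
  ultimately show ?thesis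
    by (simp only: power_add mult_ac)
qed

lemma eds9_odd:
  "eds9 \<alpha> (2 * s + 5) =
    eds9 \<alpha> (s + 4) * eds9 \<alpha> (s + 2) ^ 3 - eds9 \<alpha> (s + 1) * eds9 \<alpha> (s + 3) ^ 3"
proof -
  define k t where "k = s div 9" and "t = s mod 9"
  have s: "s = 9 * k + t" and "t < 9"
    by (simp_all add: k_def t_def)
  define w where "w i = mon \<alpha> 14 8 6 ^ (k * (t + i)) * (- mon \<alpha> 63 36 27) ^ k\<^sup>2" for i
  define W where "W = mon \<alpha> 14 8 6 ^ (2 * k * (2 * t + 5)) * (- mon \<alpha> 63 36 27) ^ (2 * k)\<^sup>2"
  have shift: "eds9 \<alpha> (s + i) = eds9 \<alpha> (t + i) * w i" for i
    using eds9_shift[of \<alpha> k "t + i"] by (simp add: s w_def add.assoc)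
  have shift2: "eds9 \<alpha> (2 * s + 5) = eds9 \<alpha> (2 * t + 5) * W"
    using eds9_shift[of \<alpha> "2 * k" "2 * t + 5"] by (simp add: s W_def add.assoc)
  \<comment> \<open>Both products have index sum \<open>4 * t + 10\<close>, twice the index
    \<open>2 * t + 5\<close>, so the whole identity of one period is scaled by
    \<open>W\<close>.\<close>
  have "w 4 * w 2 * w 2 * w 2 = W" "w 1 * w 3 * w 3 * w 3 = W"
    unfolding w_def W_def by (rule twist_mult; simp)+
  with eds9_odd_period[OF \<open>t < 9\<close>, of \<alpha>] show ?thesis
    unfolding shift shift2 by algebra
qed

lemma eds9_even:
  "eds9 \<alpha> (2 * s + 4) * eds9 \<alpha> 2 =
    eds9 \<alpha> (s + 2) *
      (eds9 \<alpha> (s + 4) * (eds9 \<alpha> (s + 1))\<^sup>2 - eds9 \<alpha> s * (eds9 \<alpha> (s + 3))\<^sup>2)"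
proof -
  define k t where "k = s div 9" and "t = s mod 9"
  have s: "s = 9 * k + t" and "t < 9"
    by (simp_all add: k_def t_def)
  define w where "w i = mon \<alpha> 14 8 6 ^ (k * (t + i)) * (- mon \<alpha> 63 36 27) ^ k\<^sup>2" for i
  define W where "W = mon \<alpha> 14 8 6 ^ (2 * k * (2 * t + 4)) * (- mon \<alpha> 63 36 27) ^ (2 * k)\<^sup>2"
  have shift: "eds9 \<alpha> (s + i) = eds9 \<alpha> (t + i) * w i" for i
    using eds9_shift[of \<alpha> k "t + i"] by (simp add: s w_def add.assoc)
  have shift0: "eds9 \<alpha> s = eds9 \<alpha> t * w 0"
    using shift[of 0] by simp
  have shift2: "eds9 \<alpha> (2 * s + 4) = eds9 \<alpha> (2 * t + 4) * W"
    using eds9_shift[of \<alpha> "2 * k" "2 * t + 4"] by (simp add: s W_def add.assoc)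
  \<comment> \<open>Here the index sums are \<open>4 * t + 8\<close>; the factor
    \<open>eds9 \<alpha> 2\<close> on the left is not shifted and carries no twist.\<close>
  have "w 2 * w 4 * w 1 * w 1 = W" "w 2 * w 0 * w 3 * w 3 = W"
    unfolding w_def W_def by (rule twist_mult; simp)+
  with eds9_even_period[OF \<open>t < 9\<close>, of \<alpha>] show ?thesis
    unfolding shift shift0 shift2 by algebra
qed

section \<open>Identification of the given sequence with the closed form\<close>

lemma eds9_unique:
  fixes \<alpha> :: int and h :: "nat \<Rightarrow> rat"
  assumes "\<alpha> \<noteq> 0" and "\<alpha> \<noteq> 1"
    and init: "h 0 = 0" "h 1 = 1" "h 2 = of_int (eds9 \<alpha> 2)" "h 3 = of_int (eds9 \<alpha> 3)"
      "h 4 = of_int (eds9 \<alpha> 4)"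
    and odd: "\<And>m. m \<ge> 2 \<Longrightarrow>
          h (2 * m + 1) = h (m + 2) * h m ^ 3 - h (m - 1) * h (m + 1) ^ 3"
    and even: "\<And>m. m \<ge> 3 \<Longrightarrow>
          h (2 * m) = h m * (h (m + 2) * (h (m - 1))\<^sup>2 - h (m - 2) * (h (m + 1))\<^sup>2) / h 2"
  shows "h n = of_int (eds9 \<alpha> n)"
proof (induction n rule: less_induct)
  case (less n)
  \<comment> \<open>The induction hypothesis is needed at \<open>s + 4\<close>, which lies below
    \<open>2 * s + 4\<close> only for \<open>s > 0\<close>; so index 4 counts as an initial
    value.\<close>
  have "n = 0 \<or> n = 1 \<or> n = 2 \<or> n = 3 \<or> n = 4 \<or> (\<exists>s. n = 2 * s + 5) \<or> (\<exists>s>0. n = 2 * s + 4)"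
    by presburger
  then consider "n = 0" | "n = 1" | "n = 2" | "n = 3" | "n = 4"
    | s where "n = 2 * s + 5" | s where "n = 2 * s + 4" "s > 0"
    by blast
  then show ?case
  proof cases
    case (6 s)
    have "h n = h (s + 4) * h (s + 2) ^ 3 - h (s + 1) * h (s + 3) ^ 3"
      using odd[of "s + 2"] by (simp add: 6 algebra_simps eval_nat_numeral)
    also have "\<dots> = of_int (eds9 \<alpha> n)"
      by (simp add: 6 less.IH eds9_odd)
    finally show ?thesis .
  next
    case (7 s)
    have "eds9 \<alpha> 2 \<noteq> 0"
      using assms(1,2) by (simp add: eds9_values mon_nonzero)
    moreover have "h n = h (s + 2) * (h (s + 4) * (h (s + 1))\<^sup>2 - h s * (h (s + 3))\<^sup>2) / h 2"
      using even[of "s + 2"] 7 by (simp add: algebra_simps eval_nat_numeral)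
    moreover have "h (s + 2) * (h (s + 4) * (h (s + 1))\<^sup>2 - h s * (h (s + 3))\<^sup>2) =
        of_int (eds9 \<alpha> n * eds9 \<alpha> 2)"
      unfolding 7 eds9_even using 7 by (simp add: less.IH)
    ultimately show ?thesis
      by (simp add: init)
  qed (use init in \<open>simp_all add: eds9_values\<close>)
qed

section \<open>Squares up to sign\<close>

lemma signed_square_of_int:
  "signed_square (of_int x :: 'a::ring_char_0) \<longleftrightarrow> signed_square x"
  unfolding signed_square_def by (metis of_int_eq_iff of_int_minus of_int_eq_id id_apply)

lemma signed_square_minus: "signed_square (- x) \<longleftrightarrow> signed_square x"
  unfolding signed_square_def by (metis minus_minus)

lemma signed_square_power2: "y \<noteq> 0 \<Longrightarrow> signed_square (y\<^sup>2)" for y :: int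
  unfolding signed_square_def by auto

lemma signed_square_mult_power2:
  fixes x y :: int
  assumes "y \<noteq> 0"
  shows "signed_square (x * y\<^sup>2) \<longleftrightarrow> signed_square x"
proof
  assume "signed_square x"
  then obtain b where "b \<noteq> 0" "x = b\<^sup>2 \<or> x = - b\<^sup>2"
    by (auto simp: signed_square_def)
  with assms show "signed_square (x * y\<^sup>2)"
    unfolding signed_square_def
    by (intro exI[of _ "b * y"]) (auto simp: power_mult_distrib)
next
  assume "signed_square (x * y\<^sup>2)"
  then obtain b where b: "b \<noteq> 0" "x * y\<^sup>2 = b\<^sup>2 \<or> x * y\<^sup>2 = - b\<^sup>2"
    by (auto simp: signed_square_def)
  \<comment> \<open>Divisibility of squares descends to the roots, so the quotient \<open>c\<close>
    of the roots is an integer.\<close>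
  then have "y\<^sup>2 dvd b\<^sup>2"
    by (metis dvd_minus_iff dvd_triv_right)
  then obtain c where c: "b = y * c"
    by (auto simp: pow_divides_pow_iff)
  then have "x * y\<^sup>2 = c\<^sup>2 * y\<^sup>2 \<or> x * y\<^sup>2 = (- c\<^sup>2) * y\<^sup>2"
    using b(2) by (simp add: power_mult_distrib mult.commute)
  then have "x = c\<^sup>2 \<or> x = - c\<^sup>2"
    using assms by (metis mult_right_cancel power_not_zero)
  then show "signed_square x"
    using b c unfolding signed_square_def by auto
qed

section \<open>Squares among the terms, by residue modulo 18\<close>

lemma mon_double: "mon \<alpha> (2 * a) (2 * b) (2 * c) = (mon \<alpha> a b c)\<^sup>2"
  by (simp add: mon_power mult.commute)

text \<open>A shift by an even number of periods has even exponents of \<open>A\<close> and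
  \<open>B\<close>, so the twist is a nonzero square. One period would not do: the exponents 63 and
  27 in \<open>B\<close> are odd.\<close>

lemma signed_square_eds9_add_18:
  assumes "\<alpha> \<noteq> 0" "\<alpha> \<noteq> 1"
  shows "signed_square (eds9 \<alpha> (18 * j + n)) \<longleftrightarrow> signed_square (eds9 \<alpha> n)"
proof -
  define y where "y = mon \<alpha> 14 8 6 ^ (j * n) * (- mon \<alpha> 63 36 27) ^ (2 * j\<^sup>2)"
  have "eds9 \<alpha> (18 * j + n) = eds9 \<alpha> n * y\<^sup>2"
    using eds9_shift[of \<alpha> "2 * j" n]
    by (simp add: y_def power_mult_distrib power_mult[symmetric] mult_ac)
  moreover have "y \<noteq> 0"
    using assms by (simp add: y_def mon_nonzero)
  ultimately show ?thesis
    by (simp add: signed_square_mult_power2)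
qed

text \<open>At index 17 all three exponents are even. At 5 and 13 only the exponent of \<alpha> is
  odd, which leaves \<alpha> times a square, up to sign.\<close>

lemma signed_square_eds9_base_cases:
  assumes "\<alpha> \<noteq> 0" "\<alpha> \<noteq> 1"
  shows "signed_square (eds9 \<alpha> 1)" "signed_square (eds9 \<alpha> 17)"
    "signed_square (eds9 \<alpha> 5) \<longleftrightarrow> signed_square \<alpha>"
    "signed_square (eds9 \<alpha> 13) \<longleftrightarrow> signed_square \<alpha>"
proof -
  show "signed_square (eds9 \<alpha> 1)"
    using signed_square_power2[of 1] by (simp add: eds9_values)
  show "signed_square (eds9 \<alpha> 17)"
    using mon_double[of \<alpha> 112 64 48] assms
    by (simp add: eds9_small_values signed_square_minus signed_square_power2 mon_nonzero)
  have alpha: "mon \<alpha> (2 * a + 1) (2 * b) (2 * c) = \<alpha> * (mon \<alpha> a b c)\<^sup>2" for a b c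
    by (simp add: mon_def power_mult_distrib power_mult[symmetric] mult_ac)
  show "signed_square (eds9 \<alpha> 5) \<longleftrightarrow> signed_square \<alpha>"
    using alpha[of 9 5 4] assms
    by (simp add: eds9_small_values signed_square_mult_power2 mon_nonzero)
  show "signed_square (eds9 \<alpha> 13) \<longleftrightarrow> signed_square \<alpha>"
    using alpha[of 65 37 28] assms
    by (simp add: eds9_small_values signed_square_minus signed_square_mult_power2 mon_nonzero)
qed

theorem theorem5p15:
  fixes \<alpha> \<gamma> :: int and h :: "nat \<Rightarrow> rat"
  assumes "\<alpha> \<noteq> 0" and "\<alpha> \<noteq> 1"
    and "\<gamma> = \<alpha>\<^sup>2 - \<alpha> + 1"
    and "h 0 = 0" and "h 1 = 1"
    and "h 2 = of_int (- (\<alpha>^2 * (\<alpha> - 1) * \<gamma>))"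
    and "h 3 = of_int (- (\<alpha>^6 * (\<alpha> - 1)^3 * \<gamma>^3))"
    and "h 4 = of_int (\<alpha>^12 * (\<alpha> - 1)^6 * \<gamma>^5)"
    and "\<And>m. m \<ge> 2 \<Longrightarrow>
          h (2 * m + 1) = h (m + 2) * h m ^ 3 - h (m - 1) * h (m + 1) ^ 3"
    and "\<And>m. m \<ge> 3 \<Longrightarrow>
          h (2 * m) = h m * (h (m + 2) * (h (m - 1))\<^sup>2 - h (m - 2) * (h (m + 1))\<^sup>2) / h 2"
  shows "(\<forall>n. [n = 1] (mod 18) \<or> [n = 17] (mod 18) \<longrightarrow> signed_square (h n)) \<and>
         (\<forall>n. [n = 5] (mod 18) \<or> [n = 13] (mod 18) \<longrightarrow>
              (signed_square (h n) \<longleftrightarrow> signed_square \<alpha>))"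
proof -
  have h: "h n = of_int (eds9 \<alpha> n)" for n
    by (rule eds9_unique) (use assms in \<open>simp_all add: eds9_values mon_def\<close>)
  have residue: "signed_square (h n) \<longleftrightarrow> signed_square (eds9 \<alpha> (n mod 18))" for n
    using signed_square_eds9_add_18[OF assms(1,2), of "n div 18" "n mod 18"]
    by (simp add: h signed_square_of_int)
  show ?thesis
    using signed_square_eds9_base_cases[OF assms(1,2)]
    by (auto simp: residue cong_def simp del: One_nat_def)
qed

end
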